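(* Let $n\in S$, let $f=f_n$ be a function of the form described in the context, let $r>0$ and let $\xi=\xi(n)>0$ be any (small) positive number. Then $$\mathcal{V}(X)\ll\left(\sum_{\substack{\lambda,\lambda'\in\mathcal{E}_n\\ 0<\|\lambda-\lambda'\|<1/(\xi r)}}|c_\lambda c_{\lambda'}|^2+\xi^3\right) r^4,$$ where the implied constant is absolute.
   Context: Let $\mathbb{T}=\mathbb{R}^2/\mathbb{Z}^2$ and $e(t)=e^{2\pi i t}$. Let $S=\{a^2+b^2:a,b\in\mathbb{Z}\}$, and for $n\in S$ let $\mathcal{E}_n=\{\lambda\in\mathbb{Z}^2:\|\lambda\|^2=n\}$. Functions considered: $f_n(x)=\sum_{\lambda\in\mathcal{E}_n}c_\lambda e(\langle x,\lambda\rangle)$ with $c_{-\lambda}=\overline{c_\lambda}$ and $\sum_{\lambda}|c_\lambda|^2=1$. For $x\in\mathbb{T}$, $r>0$, $\int_{B_x(r)}f(y)^2dy$ is the integral of $f^2$ (as a $\mathbb{Z}^2$-periodic function on $\mathbb{R}^2$) over the Euclidean disc of radius $r$ centred at a lift of $x$. Set $X_x=\int_{B_x(r)}f(y)^2dy$, regarded as a random variable in $x$ uniformly distributed on $\mathbb{T}$ (its mean is $\pi r^2$), and define the variance $\mathcal{V}(X)=\int_{\mathbb{T}}\left(X_x-\pi r^2\right)^2dx$. *)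

theory Defs
  imports "HOL-Analysis.Analysis"
begin

definition additive_char :: "real \<Rightarrow> complex" where
  "additive_char t = exp (2 * complex_of_real pi * \<i> * complex_of_real t)"

definition sums_of_two_squares :: "int set" where
  "sums_of_two_squares = {a\<^sup>2 + b\<^sup>2 | a b. True}"

text \<open>The norm on \<^typ>\<open>real \<times> real\<close> is the Euclidean one.\<close>

definition lattice_circle :: "int \<Rightarrow> (real \<times> real) set" where
  "lattice_circle n = {\<mu> \<in> \<int> \<times> \<int>. (norm \<mu>)\<^sup>2 = of_int n}"

text \<open>
  The symmetry of the coefficients makes the trigonometric sum real, so \<open>f\<close> is taken to be
  real-valued; its \<open>\<int>\<^sup>2\<close>-periodicity is automatic.
\<close>

definition toral_eigenfunction ::
    "int \<Rightarrow> (real \<times> real \<Rightarrow> complex) \<Rightarrow> (real \<times> real \<Rightarrow> real) \<Rightarrow> bool" where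
  "toral_eigenfunction n c f \<longleftrightarrow>
     (\<forall>\<mu>\<in>lattice_circle n. c (- \<mu>) = cnj (c \<mu>)) \<and>
     (\<Sum>\<mu>\<in>lattice_circle n. (cmod (c \<mu>))\<^sup>2) = 1 \<and>
     (\<forall>x. complex_of_real (f x) = (\<Sum>\<mu>\<in>lattice_circle n. c \<mu> * additive_char (x \<bullet> \<mu>)))"

definition disc_mass :: "(real \<times> real \<Rightarrow> real) \<Rightarrow> real \<Rightarrow> real \<times> real \<Rightarrow> real" where
  "disc_mass f r x = (LINT y:ball x r|lborel. (f y)\<^sup>2)"

text \<open>
  Integration over the torus \<open>\<real>\<^sup>2/\<int>\<^sup>2\<close> is integration over the fundamental domain \<open>[0,1)\<^sup>2\<close>.
\<close>

definition disc_mass_variance :: "(real \<times> real \<Rightarrow> real) \<Rightarrow> real \<Rightarrow> real" where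
  "disc_mass_variance f r =
     (LINT x:{0..<1} \<times> {0..<1}|lborel. (disc_mass f r x - pi * r\<^sup>2)\<^sup>2)"

lemma finite_lattice_circle: "finite (lattice_circle n)"
proof (rule finite_subset)
  let ?I = "real_of_int ` {- n..n}"
  have bd: "k \<in> {- n..n}" if "k\<^sup>2 \<le> n" for k :: int
  proof -
    have "\<bar>k\<bar> \<le> \<bar>k\<bar>\<^sup>2"
      using self_le_power[of "\<bar>k\<bar>" 2] by (cases "k = 0") auto
    with that show ?thesis by (simp add: abs_le_iff)
  qed
  show "lattice_circle n \<subseteq> ?I \<times> ?I"
  proof
    fix p assume "p \<in> lattice_circle n"
    then obtain a b :: int where p: "p = (of_int a, of_int b)"
      and "(norm p)\<^sup>2 = of_int n"
      by (auto simp: lattice_circle_def elim!: Ints_cases)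
    then have "real_of_int (a\<^sup>2 + b\<^sup>2) = real_of_int n"
      by (simp add: norm_Pair)
    then have "a\<^sup>2 + b\<^sup>2 = n" by (simp only: of_int_eq_iff)
    then have "a\<^sup>2 \<le> n" "b\<^sup>2 \<le> n" by (auto simp flip: \<open>a\<^sup>2 + b\<^sup>2 = n\<close>)
    then show "p \<in> ?I \<times> ?I" using bd p by blast
  qed
qed simp

lemma trigonometric_sum_real:
  assumes "\<forall>\<mu>\<in>lattice_circle n. c (- \<mu>) = cnj (c \<mu>)"
  shows "(\<Sum>\<mu>\<in>lattice_circle n. c \<mu> * additive_char (x \<bullet> \<mu>)) \<in> \<real>"
proof -
  let ?s = "\<Sum>\<mu>\<in>lattice_circle n. c \<mu> * additive_char (x \<bullet> \<mu>)"
  have neg: "- \<mu> \<in> lattice_circle n" if "\<mu> \<in> lattice_circle n" for \<mu>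
    using that unfolding lattice_circle_def mem_Collect_eq norm_minus_cancel
    by (cases \<mu>) simp
  have "cnj ?s = (\<Sum>\<mu>\<in>lattice_circle n. c (- \<mu>) * additive_char (x \<bullet> (- \<mu>)))"
    using assms by (simp add: additive_char_def exp_cnj cong: sum.cong)
  also have "\<dots> = ?s"
    by (rule sum.reindex_bij_witness[where i = uminus and j = uminus]) (auto intro: neg)
  finally show ?thesis by (simp add: Reals_cnj_iff)
qed

end

theory Submission
  imports Defs
begin

text \<open>
  The centred disc mass is the trigonometric polynomial with coefficient
  \<open>c \<mu> * cnj (c \<nu>) * K (\<mu> - \<nu>)\<close> at frequency \<open>\<mu> - \<nu>\<close>, over pairs \<open>\<mu> \<noteq> \<nu>\<close>, where \<open>K\<close> is the Fourier
  transform of the indicator of the disc of radius \<open>r\<close>. A nonzero vector is the difference of at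
  most two pairs of points of a circle, so by orthogonality the variance is at most twice the sum
  of \<open>\<bar>c \<mu> * c \<nu>\<bar>\<^sup>2 * \<bar>K (\<mu> - \<nu>)\<bar>\<^sup>2\<close>. Close pairs are treated with the trivial bound
  \<open>\<bar>K\<bar> \<le> \<pi> * r\<^sup>2\<close>, the others with the decay \<open>\<bar>K \<delta>\<bar>\<^sup>2 \<le> 8 * r / \<bar>\<delta>\<bar>\<^sup>3\<close>.

  For the decay, a shear reduces \<open>K\<close> to the Fourier integral of the semicircle profile
  \<open>g t = sqrt (R\<^sup>2 - t\<^sup>2)\<close> at a frequency \<open>a\<close>. With \<open>h = 1 / (2 * \<bar>a\<bar>)\<close>, translation by \<open>h\<close> changes the
  sign of the character, so this integral is bounded by a quarter of the \<open>L\<^sup>1\<close> norm of the second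
  difference of \<open>g\<close> with step \<open>h\<close>. That difference has integral zero and, by concavity, is positive
  only within \<open>h\<close> of the endpoints, where it is at most \<open>2 * sqrt (R * h)\<close>.
\<close>

section \<open>The additive character\<close>

lemma additive_char_eq_cis: "additive_char t = cis (2 * pi * t)"
  by (simp add: additive_char_def cis_conv_exp mult_ac)

lemma norm_additive_char [simp]: "cmod (additive_char t) = 1"
  by (simp add: additive_char_eq_cis)

lemma additive_char_add: "additive_char (s + t) = additive_char s * additive_char t"
  by (simp add: additive_char_eq_cis cis_mult distrib_left)

lemma cnj_additive_char: "cnj (additive_char t) = additive_char (- t)"
  by (simp add: additive_char_eq_cis cis_cnj)

lemma additive_char_0 [simp]: "additive_char 0 = 1"
  by (simp add: additive_char_eq_cis)

lemma continuous_on_additive_char [continuous_intros]: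
  "continuous_on A g \<Longrightarrow> continuous_on A (\<lambda>x. additive_char (g x))"
  unfolding additive_char_def by (intro continuous_intros)

lemma borel_measurable_additive_char [measurable]: "additive_char \<in> borel_measurable borel"
  by (intro borel_measurable_continuous_onI continuous_intros)

section \<open>Fourier decay of the semicircle profile\<close>

text \<open>The truncation by \<open>max\<close> extends the profile by zero to a continuous
  function on the whole line, so it can be translated freely and integrated without boundary
  terms.\<close>

definition semicircle :: "real \<Rightarrow> real \<Rightarrow> real" where
  "semicircle R t = sqrt (max 0 (R\<^sup>2 - t\<^sup>2))"

lemma semicircle_nonneg: "0 \<le> semicircle R t"
  by (simp add: semicircle_def)

lemma semicircle_minus [simp]: "semicircle R (- t) = semicircle R t"
  by (simp add: semicircle_def)

lemma semicircle_eq_0: "0 \<le> R \<Longrightarrow> R \<le> \<bar>t\<bar> \<Longrightarrow> semicircle R t = 0"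
  using abs_le_square_iff[of R t] by (simp add: semicircle_def)

text \<open>The square of a sum of two numbers is at most twice the sum of their squares. For the
  two outer values this bound equals \<open>4 * (R\<^sup>2 - t\<^sup>2) - 4 * h\<^sup>2\<close>,
  already below the square of the right-hand side.\<close>

lemma semicircle_midpoint_concave:
  assumes "\<bar>t + h\<bar> \<le> R" "\<bar>t - h\<bar> \<le> R"
  shows "semicircle R (t + h) + semicircle R (t - h) \<le> 2 * semicircle R t"
proof -
  have R: "0 \<le> R" using assms by linarith
  have t: "\<bar>t\<bar> \<le> R" using assms by linarith
  have sq: "(semicircle R s)\<^sup>2 = R\<^sup>2 - s\<^sup>2" if "\<bar>s\<bar> \<le> R" for s
    using that R abs_le_square_iff[of s R] by (simp add: semicircle_def)
  have "(semicircle R (t + h) + semicircle R (t - h))\<^sup>2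
      \<le> 2 * ((semicircle R (t + h))\<^sup>2 + (semicircle R (t - h))\<^sup>2)"
    using sum_squares_bound[of "semicircle R (t + h)" "semicircle R (t - h)"]
    by (simp add: power2_sum algebra_simps)
  also have "\<dots> = 4 * (R\<^sup>2 - t\<^sup>2) - 4 * h\<^sup>2"
    by (simp add: sq assms power2_sum power2_diff)
  also have "\<dots> \<le> (2 * semicircle R t)\<^sup>2"
    by (simp add: power_mult_distrib sq t)
  finally show ?thesis
    by (rule power2_le_imp_le) (simp add: semicircle_nonneg)
qed

text \<open>The margin is \<open>2 * h\<close> because the bound is applied at
  \<open>u = t - h\<close> with \<open>t > R - h\<close>. If \<open>2 * h\<close> exceeds
  \<open>R\<close>, then \<open>R\<^sup>2\<close> itself is at most
  \<open>2 * (R * h)\<close>.\<close>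

lemma semicircle_le_near_edge:
  assumes "0 \<le> R" "0 \<le> h" "R - 2 * h \<le> u"
  shows "semicircle R u \<le> 2 * sqrt (R * h)"
proof -
  have "R\<^sup>2 - u\<^sup>2 \<le> 4 * (R * h)"
  proof (cases "0 \<le> R - 2 * h")
    case True
    then have "(R - 2 * h)\<^sup>2 \<le> u\<^sup>2" using assms by (intro power_mono) auto
    moreover have "(R - 2 * h)\<^sup>2 = R\<^sup>2 - 4 * (R * h) + 4 * h\<^sup>2"
      by (simp add: power2_diff power_mult_distrib)
    ultimately show ?thesis using zero_le_power2[of h] by linarith
  next
    case False
    then have "R * R \<le> R * (2 * h)" using assms by (intro mult_left_mono) auto
    moreover have "0 \<le> R * h" "0 \<le> u\<^sup>2" using assms by auto
    ultimately show ?thesis unfolding power2_eq_square by linarith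
  qed
  then have "semicircle R u \<le> sqrt (4 * (R * h))"
    using assms unfolding semicircle_def by (intro real_sqrt_le_mono) simp
  then show ?thesis by (simp add: real_sqrt_mult)
qed

text \<open>By evenness only \<open>t \<ge> 0\<close> matters. Up to \<open>R - h\<close> concavity
  makes the left side nonpositive; beyond it the outer translate vanishes, and only the inner one
  can contribute positively, until it vanishes too past \<open>R + h\<close>.\<close>

lemma semicircle_second_difference_le:
  assumes R: "0 \<le> R" and h: "0 \<le> h"
  shows "semicircle R (t + h) + semicircle R (t - h) - 2 * semicircle R t
    \<le> 2 * sqrt (R * h) * (indicator {R - h..R + h} t + indicator {- R - h..h - R} t)"
proof -
  have pos: "semicircle R (t + h) + semicircle R (t - h) - 2 * semicircle R t
    \<le> 2 * sqrt (R * h) * (indicator {R - h..R + h} t + indicator {- R - h..h - R} t)"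
    if t: "0 \<le> t" for t
  proof (cases "t \<le> R - h")
    case True
    then have "\<bar>t + h\<bar> \<le> R" "\<bar>t - h\<bar> \<le> R" using t h by auto
    then have "semicircle R (t + h) + semicircle R (t - h) - 2 * semicircle R t \<le> 0"
      using semicircle_midpoint_concave[of t h R] by simp
    also have "0 \<le> 2 * sqrt (R * h) * (indicator {R - h..R + h} t + indicator {- R - h..h - R} t)"
      using R h by simp
    finally show ?thesis .
  next
    case False
    then have 0: "semicircle R (t + h) = 0"
      using R h t by (intro semicircle_eq_0) auto
    show ?thesis
    proof (cases "t \<le> R + h")
      case True
      have "semicircle R (t - h) \<le> 2 * sqrt (R * h)"
        using False by (intro semicircle_le_near_edge R h) auto
      \<comment> \<open>The two windows can overlap when \<open>h \<ge> R\<close>, so the second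
        indicator is carried along as a nonnegative extra term.\<close>
      also have "\<dots> \<le> 2 * sqrt (R * h) * (indicator {R - h..R + h} t + indicator {- R - h..h - R} t)"
        using True False R h mult_left_mono[of 1 "1 + indicator {- R - h..h - R} t" "2 * sqrt (R * h)"]
        by simp
      finally show ?thesis using 0 semicircle_nonneg[of R t] by linarith
    next
      case False
      then have "semicircle R (t - h) = 0" using R h by (intro semicircle_eq_0) auto
      moreover have "0 \<le> 2 * sqrt (R * h) * (indicator {R - h..R + h} t + indicator {- R - h..h - R} t)"
        using R h by simp
      ultimately show ?thesis using 0 semicircle_nonneg[of R t] by linarith
    qed
  qed
  show ?thesis
  proof (cases "0 \<le> t")
    case False
    \<comment> \<open>Reflection exchanges the two translates and the two windows, so the claim at
      \<open>- t\<close> is the claim at \<open>t\<close>.\<close>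
    have "- t + h = - (t - h)" "- t - h = - (t + h)" by simp_all
    then have e: "semicircle R (- t + h) = semicircle R (t - h)" "semicircle R (- t - h) = semicircle R (t + h)"
      by (simp_all only: semicircle_minus)
    have i: "indicator {R - h..R + h} (- t) = (indicator {- R - h..h - R} t :: real)"
      "indicator {- R - h..h - R} (- t) = (indicator {R - h..R + h} t :: real)"
      by (auto simp: indicator_def)
    show ?thesis using pos[of "- t"] False
      unfolding e i semicircle_minus by (simp only: add.commute)
  qed (rule pos)
qed

lemma continuous_on_semicircle [continuous_intros]:
  "continuous_on A g \<Longrightarrow> continuous_on A (\<lambda>x. semicircle R (g x))"
  unfolding semicircle_def by (intro continuous_intros)

lemma borel_measurable_semicircle [measurable]: "semicircle R \<in> borel_measurable borel"
  by (intro borel_measurable_continuous_onI continuous_intros)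

lemma integrable_semicircle:
  assumes "0 \<le> R" shows "integrable lborel (semicircle R)"
proof (rule Bochner_Integration.integrable_bound)
  show "integrable lborel (\<lambda>t. R * indicator {-R..R} t :: real)"
    by (intro integrable_mult_right integrable_real_indicator) (auto simp: emeasure_lborel_Icc_eq)
  show "AE t in lborel. norm (semicircle R t) \<le> norm (R * indicator {-R..R} t)"
  proof (rule AE_I2)
    fix t
    show "norm (semicircle R t) \<le> norm (R * indicator {-R..R} t)"
    proof (cases "t \<in> {-R..R}")
      case True
      have "semicircle R t \<le> sqrt (R\<^sup>2)"
        unfolding semicircle_def by (intro real_sqrt_le_mono) simp
      with True assms show ?thesis by (simp add: semicircle_nonneg)
    next
      case False
      then have "R \<le> \<bar>t\<bar>" by auto
      with False assms show ?thesis by (simp add: semicircle_eq_0)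
    qed
  qed
qed simp

lemma integrable_semicircle_char:
  assumes "0 \<le> R"
  shows "integrable lborel (\<lambda>t. of_real (semicircle R t) * additive_char (a * t))"
  using integrable_semicircle[OF assms]
  by (rule Bochner_Integration.integrable_bound) (auto simp: norm_mult)

lemma integral_translate:
  fixes g :: "real \<Rightarrow> 'a::{banach, second_countable_topology}"
  shows "(LINT t|lborel. g (t + s)) = (LINT t|lborel. g t)"
  using lborel_integral_real_affine[of 1 g s] by (simp add: add.commute)

lemma integrable_translate:
  fixes g :: "real \<Rightarrow> 'a::{banach, second_countable_topology}"
  shows "integrable lborel g \<Longrightarrow> integrable lborel (\<lambda>t. g (t + s))"
  using lborel_integrable_real_affine[of g 1 s] by (simp add: add.commute)

text \<open>With \<open>h = 1 / (2 * \<bar>a\<bar>)\<close> the bound is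
  \<open>4 * sqrt (R * h) * h\<close>: the square-root vanishing at the endpoints saves half a power
  of \<open>h\<close>, and the length of the windows saves a full one.\<close>

lemma semicircle_fourier_bound:
  assumes R: "0 \<le> R" and a: "a \<noteq> 0"
  shows "cmod (LINT t|lborel. of_real (semicircle R t) * additive_char (a * t))
    \<le> 4 * sqrt (R * (1 / (2 * \<bar>a\<bar>))) * (1 / (2 * \<bar>a\<bar>))"
proof -
  define h where "h = 1 / (2 * \<bar>a\<bar>)"
  have h: "0 < h" using a by (simp add: h_def)
  define g where "g = semicircle R"
  define F where "F t = of_real (g t) * additive_char (a * t)" for t
  define \<Delta> where "\<Delta> t = g (t + h) + g (t - h) - 2 * g t" for t
  have ig: "integrable lborel g" and iF: "integrable lborel F"
    using integrable_semicircle[OF R] integrable_semicircle_char[OF R, of a]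
    by (simp_all add: g_def F_def[abs_def])
  have igs: "integrable lborel (\<lambda>t. g (t + s))" and iFs: "integrable lborel (\<lambda>t. F (t + s))" for s
    using ig iF by (auto intro: integrable_translate)
  have i\<Delta>: "integrable lborel \<Delta>"
    unfolding \<Delta>_def using ig igs[of h] igs[of "- h"] by simp
  \<comment> \<open>Here \<open>a * h\<close> is 1/2 or -1/2, so both translates enter with the sign
    of \<open>- 2 * g t\<close>, and the Fourier integral of \<Delta> is -4 times that of
    \<open>g\<close>.\<close>
  have ah: "additive_char (a * h) = - 1" "additive_char (- (a * h)) = - 1"
    using a by (auto simp: h_def additive_char_eq_cis abs_if simp flip: cis_cnj)
  have shift: "of_real (g (t + s)) * additive_char (a * t) = additive_char (- (a * s)) * F (t + s)" for t s
    by (simp add: F_def ring_distribs flip: additive_char_add)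
  have "of_real (\<Delta> t) * additive_char (a * t) = - F (t + h) - F (t - h) - 2 * F t" for t
    using shift[of t h] shift[of t "- h"] ah
    by (simp add: \<Delta>_def F_def[of t] algebra_simps)
  then have "(LINT t|lborel. of_real (\<Delta> t) * additive_char (a * t))
      = (LINT t|lborel. - F (t + h) - F (t + - h) - 2 * F t)" by simp
  also have "\<dots> = - (LINT t|lborel. F (t + h)) - (LINT t|lborel. F (t + - h)) - 2 * (LINT t|lborel. F t)"
    using iF iFs by (simp del: add_uminus_conv_diff)
  also have "\<dots> = - 4 * (LINT t|lborel. F t)"
    unfolding integral_translate by simp
  finally have "4 * cmod (LINT t|lborel. F t) = cmod (LINT t|lborel. of_real (\<Delta> t) * additive_char (a * t))"
    by (simp add: norm_mult)
  also have "\<dots> \<le> (LINT t|lborel. cmod (of_real (\<Delta> t) * additive_char (a * t)))"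
    by (rule integral_norm_bound)
  also have "\<dots> = (LINT t|lborel. \<bar>\<Delta> t\<bar>)"
    by (simp add: norm_mult)
  \<comment> \<open>If M is nonnegative and dominates \<Delta>, then the absolute value of \<Delta>
    is at most 2 M - \<Delta>. As \<Delta> has integral zero, only the integral of M, over two
    windows of length \<open>2 * h\<close>, remains.\<close>
  also have "\<dots> \<le> (LINT t|lborel. 2 * (2 * sqrt (R * h) *
      (indicator {R - h..R + h} t + indicator {- R - h..h - R} t)) - \<Delta> t)"
  proof (rule integral_mono)
    show "integrable lborel (\<lambda>t. 2 * (2 * sqrt (R * h) *
      (indicator {R - h..R + h} t + indicator {- R - h..h - R} t)) - \<Delta> t)"
      by (intro Bochner_Integration.integrable_diff Bochner_Integration.integrable_add
          integrable_mult_right integrable_real_indicator i\<Delta>) (auto simp: emeasure_lborel_Icc_eq)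
    fix t
    have "\<Delta> t \<le> 2 * sqrt (R * h) * (indicator {R - h..R + h} t + indicator {- R - h..h - R} t)"
      unfolding \<Delta>_def g_def using R h by (intro semicircle_second_difference_le) auto
    moreover have "0 \<le> 2 * sqrt (R * h) * (indicator {R - h..R + h} t + indicator {- R - h..h - R} t)"
      using R h by simp
    ultimately show "\<bar>\<Delta> t\<bar> \<le> 2 * (2 * sqrt (R * h) *
      (indicator {R - h..R + h} t + indicator {- R - h..h - R} t)) - \<Delta> t"
      by linarith
  qed (use i\<Delta> in simp)
  also have "\<dots> = 2 * (2 * sqrt (R * h) * (2 * h + 2 * h)) - (LINT t|lborel. \<Delta> t)"
    using i\<Delta> h by (simp add: integrable_real_indicator)
  also have "(LINT t|lborel. \<Delta> t) = 0"
    unfolding \<Delta>_def using ig igs[of h] igs[of "- h"] integral_translate[of g h] integral_translate[of g "- h"]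
    by simp
  finally show ?thesis unfolding F_def g_def h_def[symmetric] by (simp add: mult.commute)
qed


section \<open>The Fourier transform of a disc\<close>

lemma set_integrable_bounded:
  fixes f :: "'a::euclidean_space \<Rightarrow> 'b::{banach, second_countable_topology}"
  assumes A: "A \<in> sets borel" "bounded A"
    and f: "f \<in> borel_measurable borel" "\<And>y. norm (f y) \<le> B"
  shows "set_integrable lborel A f"
  unfolding set_integrable_def
proof (rule Bochner_Integration.integrable_bound)
  have "emeasure lborel A < \<infinity>" using A by (intro emeasure_bounded_finite) auto
  then show "integrable lborel (\<lambda>y. B * indicator A y)"
    using A by (intro integrable_mult_right integrable_real_indicator) auto
  show "(\<lambda>y. indicator A y *\<^sub>R f y) \<in> borel_measurable lborel"
    using A f by measurable
  have "norm (f y) \<le> \<bar>B\<bar>" for y using f(2)[of y] by linarith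
  then show "AE y in lborel. norm (indicator A y *\<^sub>R f y) \<le> norm (B * indicator A y)"
    by (auto simp: indicator_def)
qed

text \<open>For nonzero \<delta> this is classically r J_1(2 pi r |\<delta>|) / |\<delta>|, with the
  Bessel function J_1; the bounds below are obtained from the integral directly.\<close>

definition disc_fourier :: "real \<Rightarrow> real \<times> real \<Rightarrow> complex" where
  "disc_fourier r \<delta> = (LINT y:ball 0 r|lborel. additive_char (y \<bullet> \<delta>))"

lemma set_integrable_char:
  fixes \<delta> :: "real \<times> real"
  assumes "A \<in> sets borel" "bounded A"
  shows "set_integrable lborel A (\<lambda>y. additive_char (y \<bullet> \<delta>))"
  using assms by (rule set_integrable_bounded[where B = 1]) auto

text \<open>Moving the centre of the disc only multiplies the integral by a phase, so integrating
  over discs acts on characters as the Fourier multiplier \<open>disc_fourier r\<close>.\<close>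

lemma integral_char_ball:
  "(LINT y:ball x r|lborel. additive_char (y \<bullet> \<delta>)) = additive_char (x \<bullet> \<delta>) * disc_fourier r \<delta>"
proof -
  have "(LINT y:ball x r|lborel. additive_char (y \<bullet> \<delta>))
      = (LINT y|distr lborel borel ((+) x). indicator (ball x r) y *\<^sub>R additive_char (y \<bullet> \<delta>))"
    by (simp add: lborel_distr_plus set_lebesgue_integral_def)
  also have "\<dots> = (LINT y|lborel. indicator (ball x r) (x + y) *\<^sub>R additive_char ((x + y) \<bullet> \<delta>))"
    by (rule integral_distr) (auto intro!: borel_measurable_scaleR borel_measurable_indicator)
  also have "\<dots> = (LINT y|lborel. additive_char (x \<bullet> \<delta>) * (indicator (ball 0 r) y *\<^sub>R additive_char (y \<bullet> \<delta>)))"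
    by (intro Bochner_Integration.integral_cong refl)
      (auto simp: indicator_def dist_norm inner_add_left additive_char_add)
  also have "\<dots> = additive_char (x \<bullet> \<delta>) * disc_fourier r \<delta>"
    unfolding disc_fourier_def set_lebesgue_integral_def by (rule integral_mult_right_zero)
  finally show ?thesis .
qed

lemma disc_fourier_0: "0 \<le> r \<Longrightarrow> disc_fourier r 0 = of_real (pi * r\<^sup>2)"
  by (simp add: disc_fourier_def set_lebesgue_integral_def scaleR_conv_of_real content_ball unit_ball_vol_2
      emeasure_bounded_finite power2_eq_square)

lemma norm_disc_fourier_le:
  assumes "0 \<le> r" shows "cmod (disc_fourier r \<delta>) \<le> pi * r\<^sup>2"
proof -
  have "cmod (disc_fourier r \<delta>) \<le> (LINT y|lborel. cmod (indicator (ball 0 r) y *\<^sub>R additive_char (y \<bullet> \<delta>)))"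
    unfolding disc_fourier_def set_lebesgue_integral_def by (rule integral_norm_bound)
  also have "\<dots> = (LINT y|lborel. indicator (ball (0 :: real \<times> real) r) y)"
    by simp
  also have "\<dots> = pi * r\<^sup>2"
    using assms by (simp add: content_ball unit_ball_vol_2 emeasure_bounded_finite power2_eq_square)
  finally show ?thesis .
qed

text \<open>Reflection in the diagonal preserves the disc. This covers frequencies whose first
  coordinate is zero, since the shear below divides by that coordinate.\<close>

lemma disc_fourier_swap: "disc_fourier r (b, a) = disc_fourier r (a, b)"
proof -
  let ?f = "\<lambda>\<delta> y. indicator (ball 0 r) y *\<^sub>R additive_char (y \<bullet> \<delta>)"
  have "disc_fourier r (b, a) = (LINT y|(lborel \<Otimes>\<^sub>M lborel). ?f (b, a) y)"
    by (simp add: disc_fourier_def set_lebesgue_integral_def lborel_prod)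
  also have "\<dots> = (LINT y|(lborel \<Otimes>\<^sub>M lborel). (case y of (x, y) \<Rightarrow> ?f (b, a) (y, x)))"
    by (rule lborel_pair.integral_product_swap[symmetric])
      (auto simp: lborel_prod intro!: borel_measurable_scaleR borel_measurable_indicator)
  also have "\<dots> = (LINT y|(lborel \<Otimes>\<^sub>M lborel). ?f (a, b) y)"
    by (intro Bochner_Integration.integral_cong refl)
      (auto simp: indicator_def norm_Pair add.commute)
  also have "\<dots> = disc_fourier r (a, b)"
    by (simp add: disc_fourier_def set_lebesgue_integral_def lborel_prod)
  finally show ?thesis .
qed

lemma sheared_disc_chord_length:
  assumes "0 \<le> r"
  shows "(LINT y|lborel. indicator (ball 0 r) (t - \<beta> * y, y))
    = 2 * semicircle (r * sqrt (1 + \<beta>\<^sup>2)) t / (1 + \<beta>\<^sup>2)"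
proof -
  define k where "k = 1 + \<beta>\<^sup>2"
  define g where "g = semicircle (r * sqrt k) t"
  have k: "0 < k" unfolding k_def by (simp add: add_pos_nonneg)
  have g: "0 \<le> g" by (simp add: g_def semicircle_nonneg)
  have "indicator (ball 0 r) (t - \<beta> * y, y) = (indicator {(\<beta> * t - g) / k<..<(\<beta> * t + g) / k} y :: real)" for y
  proof -
    have "(t - \<beta> * y, y) \<in> ball 0 r \<longleftrightarrow> (t - \<beta> * y)\<^sup>2 + y\<^sup>2 < r\<^sup>2"
      using assms real_sqrt_less_iff[of "(t - \<beta> * y)\<^sup>2 + y\<^sup>2" "r\<^sup>2"] by (simp add: norm_Pair)
    also have "\<dots> \<longleftrightarrow> k * ((t - \<beta> * y)\<^sup>2 + y\<^sup>2) < k * r\<^sup>2"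
      using k by simp
    \<comment> \<open>Multiplying by \<open>k\<close> completes the square in \<open>y\<close>: the
      slice is an interval centred at \<open>\<beta> * t / k\<close> with half-length
      \<open>g / k\<close>.\<close>
    also have "k * ((t - \<beta> * y)\<^sup>2 + y\<^sup>2) = (k * y - \<beta> * t)\<^sup>2 + t\<^sup>2"
      by (simp add: k_def power2_eq_square algebra_simps)
    \<comment> \<open>The truncation is harmless: a square is never below zero, so both sides are
      false when the slice is empty.\<close>
    also have "(k * y - \<beta> * t)\<^sup>2 + t\<^sup>2 < k * r\<^sup>2 \<longleftrightarrow> (k * y - \<beta> * t)\<^sup>2 < max 0 ((r * sqrt k)\<^sup>2 - t\<^sup>2)"
      using k zero_le_power2[of "k * y - \<beta> * t"] by (auto simp: power_mult_distrib less_max_iff_disj mult.commute)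
    also have "\<dots> \<longleftrightarrow> \<bar>k * y - \<beta> * t\<bar> < g"
      unfolding g_def semicircle_def by (subst real_sqrt_less_iff[symmetric]) simp
    also have "\<dots> \<longleftrightarrow> y \<in> {(\<beta> * t - g) / k<..<(\<beta> * t + g) / k}"
      using k by (auto simp: field_simps abs_less_iff)
    finally show ?thesis by (simp add: indicator_def)
  qed
  then have "(LINT y|lborel. indicator (ball 0 r) (t - \<beta> * y, y))
      = (LINT y|lborel. indicator {(\<beta> * t - g) / k<..<(\<beta> * t + g) / k} y :: real)"
    by simp
  also have "\<dots> = measure lborel {(\<beta> * t - g) / k<..<(\<beta> * t + g) / k}"
    by simp
  also have "\<dots> = (\<beta> * t + g) / k - (\<beta> * t - g) / k"
    using g k by (intro measure_lborel_Ioo divide_right_mono) auto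
  also have "\<dots> = 2 * g / k" by (simp flip: diff_divide_distrib)
  finally show ?thesis by (simp add: g_def k_def)
qed

text \<open>For fixed \<open>y\<close> the change of variables is a translation in \<open>x\<close>,
  so Fubini and one-dimensional translation invariance suffice. Integrating out \<open>y\<close>
  then leaves the chord lengths of the sheared disc.\<close>

lemma disc_fourier_eq_semicircle:
  fixes r a b :: real
  assumes r: "0 \<le> r" and a: "a \<noteq> 0"
  defines "\<beta> \<equiv> b / a"
  shows "disc_fourier r (a, b) = of_real (2 / (1 + \<beta>\<^sup>2)) *
    (LINT t|lborel. of_real (semicircle (r * sqrt (1 + \<beta>\<^sup>2)) t) * additive_char (a * t))"
proof -
  \<comment> \<open>The shear \<open>x = t - \<beta> * y\<close> makes the phase \<open>a * x + b * y = a * t\<close> independent of \<open>y\<close>.\<close>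
  let ?f = "\<lambda>x y. indicator (ball 0 r) (x, y) *\<^sub>R additive_char (a * x + b * y)"
  let ?g = "\<lambda>t y. indicator (ball 0 r) (t - \<beta> * y, y) *\<^sub>R additive_char (a * t)"
  have sub: "(LINT x|lborel. ?f x y) = (LINT t|lborel. ?g t y)" for y
  proof -
    have "(LINT x|lborel. ?f x y) = (LINT t|lborel. ?f (t + - (\<beta> * y)) y)"
      by (rule integral_translate[symmetric])
    moreover have "a * (t + - (\<beta> * y)) + b * y = a * t" for t
      using a by (simp add: \<beta>_def field_simps)
    ultimately show ?thesis by simp
  qed
  \<comment> \<open>The triangle inequality applied to
    \<open>t = (t - \<beta> * y) + \<beta> * y\<close> places the sheared disc in a rectangle of
    half-width \<open>T\<close>, which gives the integrability needed for Fubini.\<close>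
  define T where "T = r * (1 + \<bar>\<beta>\<bar>)"
  have ig: "integrable (lborel \<Otimes>\<^sub>M lborel) (case_prod ?g)"
  proof (rule Bochner_Integration.integrable_bound)
    show "integrable (lborel \<Otimes>\<^sub>M lborel) (indicator ({-T..T} \<times> {-r..r}) :: real \<times> real \<Rightarrow> real)"
      using emeasure_bounded_finite[of "{-T..T} \<times> {-r..r}"]
      by (intro integrable_real_indicator) (auto simp: lborel_prod bounded_Times intro!: borel_Times)
    have m: "(\<lambda>z. (fst z - \<beta> * snd z, snd z)) -` ball 0 r \<in> sets borel"
      by (intro borel_open open_vimage continuous_intros) auto
    have "(\<lambda>z. indicator ((\<lambda>z. (fst z - \<beta> * snd z, snd z)) -` ball 0 r) z *\<^sub>R
        additive_char (a * fst z)) \<in> borel_measurable borel"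
      by (intro borel_measurable_scaleR borel_measurable_indicator m
          borel_measurable_continuous_onI[of "\<lambda>z. additive_char (a * fst z)"] continuous_intros)
    then show "case_prod ?g \<in> borel_measurable (lborel \<Otimes>\<^sub>M lborel)"
      by (simp add: lborel_prod case_prod_beta' indicator_def)
    have "\<bar>y\<bar> \<le> r" "\<bar>t\<bar> \<le> T" if "(t - \<beta> * y, y) \<in> ball 0 r" for t y
    proof -
      have n: "norm (t - \<beta> * y, y) < r" using that by simp
      show y: "\<bar>y\<bar> \<le> r" using norm_snd_le[of y "t - \<beta> * y"] n by simp
      have "\<bar>t - \<beta> * y\<bar> \<le> r" using norm_fst_le[of "t - \<beta> * y" y] n by simp
      moreover have "\<bar>\<beta> * y\<bar> \<le> \<bar>\<beta>\<bar> * r" using y by (simp add: abs_mult mult_left_mono)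
      ultimately show "\<bar>t\<bar> \<le> T" unfolding T_def by (simp add: algebra_simps abs_le_iff)
    qed
    then show "AE x in lborel \<Otimes>\<^sub>M lborel. norm (case_prod ?g x)
        \<le> norm (indicator ({-T..T} \<times> {-r..r}) x :: real)"
      by (intro AE_I2) (auto simp: indicator_def abs_le_iff minus_le_iff split: prod.splits)
  qed
  have "set_integrable lborel (ball 0 r) (\<lambda>y. additive_char (y \<bullet> (a, b)))"
    by (rule set_integrable_char) auto
  then have inf: "integrable (lborel \<Otimes>\<^sub>M lborel) (case_prod ?f)"
    by (simp add: set_integrable_def lborel_prod case_prod_beta' inner_prod_def mult.commute)
  have "disc_fourier r (a, b) = integral\<^sup>L (lborel \<Otimes>\<^sub>M lborel) (case_prod ?f)"
    by (simp add: disc_fourier_def set_lebesgue_integral_def lborel_prod case_prod_beta' inner_prod_def mult.commute)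
  also have "\<dots> = (LINT y|lborel. LINT x|lborel. ?f x y)"
    by (rule lborel_pair.integral_snd[OF inf, symmetric])
  also have "\<dots> = (LINT y|lborel. LINT t|lborel. ?g t y)"
    by (simp only: sub)
  also have "\<dots> = (LINT t|lborel. LINT y|lborel. ?g t y)"
    by (rule lborel_pair.Fubini_integral[OF ig])
  also have "\<dots> = (LINT t|lborel. (LINT y|lborel. indicator (ball 0 r) (t - \<beta> * y, y)) *\<^sub>R additive_char (a * t))"
    by (simp only: scaleR_conv_of_real integral_mult_left_zero integral_complex_of_real)
  also have "\<dots> = (LINT t|lborel. of_real (2 / (1 + \<beta>\<^sup>2)) *
      (of_real (semicircle (r * sqrt (1 + \<beta>\<^sup>2)) t) * additive_char (a * t)))"
    by (simp add: sheared_disc_chord_length[OF r] scaleR_conv_of_real mult.assoc)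
  finally show ?thesis by (simp only: integral_mult_right_zero)
qed

text \<open>Squaring avoids fractional powers. The shear factor, the enlarged radius and the
  frequency \<open>a\<close> combine to a power of \<open>norm \<delta>\<close> alone, as the
  rotational symmetry of the disc demands.\<close>

lemma disc_fourier_decay:
  assumes r: "0 \<le> r" and \<delta>: "\<delta> \<noteq> 0"
  shows "(cmod (disc_fourier r \<delta>))\<^sup>2 \<le> 8 * r / norm \<delta> ^ 3"
proof -
  have main: "(cmod (disc_fourier r (a, b)))\<^sup>2 \<le> 8 * r / norm (a, b) ^ 3" if a: "a \<noteq> 0" for a b
  proof -
    \<comment> \<open>This is the ratio of \<open>norm (a, b)\<close> to
      \<open>\<bar>a\<bar>\<close>. The squared bound is 8 r over the cube of
      \<open>\<bar>a\<bar> * s\<close>.\<close>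
    define s where "s = sqrt (1 + (b / a)\<^sup>2)"
    have s: "0 < s" "s\<^sup>2 = 1 + (b / a)\<^sup>2" by (simp_all add: s_def add_pos_nonneg)
    have "norm (a, b) = sqrt (a\<^sup>2 * (1 + (b / a)\<^sup>2))"
      using a by (simp add: norm_Pair field_simps)
    then have n: "norm (a, b) = \<bar>a\<bar> * s"
      by (simp add: s_def real_sqrt_mult)
    have "cmod (disc_fourier r (a, b)) = 2 / s\<^sup>2 *
        cmod (LINT t|lborel. of_real (semicircle (r * s) t) * additive_char (a * t))"
      using s(1) unfolding disc_fourier_eq_semicircle[OF r a] s(2)[symmetric]
      by (simp add: norm_mult norm_divide norm_power)
    also have "\<dots> \<le> 2 / s\<^sup>2 * (4 * sqrt (r * s * (1 / (2 * \<bar>a\<bar>))) * (1 / (2 * \<bar>a\<bar>)))"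
      using r s a by (intro mult_left_mono semicircle_fourier_bound) auto
    finally have "(cmod (disc_fourier r (a, b)))\<^sup>2
        \<le> (2 / s\<^sup>2 * (4 * sqrt (r * s * (1 / (2 * \<bar>a\<bar>))) * (1 / (2 * \<bar>a\<bar>))))\<^sup>2"
      by (intro power_mono) auto
    also have "\<dots> = (2 / s\<^sup>2)\<^sup>2 * (16 * (r * s * (1 / (2 * \<bar>a\<bar>))) * (1 / (2 * \<bar>a\<bar>))\<^sup>2)"
      using r s(1) by (simp only: power_mult_distrib) (simp add: power_mult_distrib)
    also have "\<dots> = 8 * r / norm (a, b) ^ 3"
      using s(1) a unfolding n by (simp add: field_simps eval_nat_numeral)
    finally show ?thesis .
  qed
  obtain a b where ab: "\<delta> = (a, b)" by (cases \<delta>)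
  show ?thesis
  proof (cases "a = 0")
    case True
    then have "b \<noteq> 0" using \<delta> ab by (auto simp: zero_prod_def)
    from main[OF this, of a] show ?thesis
      by (simp add: ab disc_fourier_swap[of r b a] norm_Pair add.commute)
  qed (simp add: ab main)
qed


section \<open>Mean squares of trigonometric polynomials\<close>

lemma additive_char_int: "d \<in> \<int> \<Longrightarrow> additive_char d = 1"
  by (auto simp: additive_char_eq_cis elim!: Ints_cases)

lemma integral_char_unit_interval:
  fixes d :: real
  assumes d: "d \<in> \<int>"
  shows "(LINT t:{0..<1}|lborel. additive_char (t * d)) = of_bool (d = 0)"
proof (cases "d = 0")
  case True
  then show ?thesis by (simp add: set_lebesgue_integral_def)
next
  case False
  let ?F = "\<lambda>t. additive_char (t * d) / (2 * of_real pi * \<i> * of_real d)"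
  have "((\<lambda>t. additive_char (t * d)) has_integral (?F 1 - ?F 0)) {0..1}"
  proof (rule fundamental_theorem_of_calculus)
    fix t :: real
    \<comment> \<open>The antiderivative is differentiated as a function of a complex variable and
      then restricted to the real axis.\<close>
    have "((\<lambda>z. exp (2 * of_real pi * \<i> * (z * of_real d)) / (2 * of_real pi * \<i> * of_real d))
        has_field_derivative exp (2 * of_real pi * \<i> * (of_real t * of_real d))) (at (of_real t))"
      using False by (auto intro!: derivative_eq_intros)
    from has_vector_derivative_real_field[OF this, of "{0..1}"]
    show "(?F has_vector_derivative additive_char (t * d)) (at t within {0..1})"
      by (simp add: additive_char_def)
  qed simp
  then have "((\<lambda>t. additive_char (t * d)) has_integral 0) {0..<1}"
    using additive_char_int[OF d]
    by (subst has_integral_spike_set_eq[where T = "{0..1}"])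
      (auto intro: negligible_subset[of "{1}"])
  moreover have "set_integrable lborel {0..<1} (\<lambda>t. additive_char (t * d))"
    by (rule set_integrable_bounded[where B = 1]) auto
  ultimately show ?thesis
    using False by (simp add: set_borel_integral_eq_integral(2) integral_unique)
qed

lemma integral_char_unit_square:
  assumes "\<delta> \<in> \<int> \<times> \<int>"
  shows "(LINT x:{0..<1} \<times> {0..<1}|lborel. additive_char (x \<bullet> \<delta>)) = of_bool (\<delta> = (0 :: real \<times> real))"
proof -
  obtain a b where \<delta>: "\<delta> = (a, b)" and ab: "a \<in> \<int>" "b \<in> \<int>" using assms by auto
  let ?f = "\<lambda>x y. (indicator {0..<1} x *\<^sub>R additive_char (x * a)) * (indicator {0..<1} y *\<^sub>R additive_char (y * b))"
  have eq: "indicator ({0..<1} \<times> {0..<1}) z *\<^sub>R additive_char (z \<bullet> \<delta>) = (case z of (x, y) \<Rightarrow> ?f x y)" for z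
    by (auto simp: \<delta> indicator_def additive_char_add split: prod.splits)
  have "set_integrable lborel ({0..<1} \<times> {0..<1}) (\<lambda>x. additive_char (x \<bullet> \<delta>))"
    by (rule set_integrable_char) (auto intro!: borel_Times bounded_Times)
  then have int: "integrable (lborel \<Otimes>\<^sub>M lborel) (case_prod ?f)"
    by (simp add: set_integrable_def eq lborel_prod)
  have "(LINT x:{0..<1} \<times> {0..<1}|lborel. additive_char (x \<bullet> \<delta>)) = integral\<^sup>L (lborel \<Otimes>\<^sub>M lborel) (case_prod ?f)"
    by (simp add: set_lebesgue_integral_def eq lborel_prod)
  also have "\<dots> = (LINT x|lborel. LINT y|lborel. ?f x y)"
    using lborel_pair.integral_fst[OF int] by simp
  also have "\<dots> = (LINT x:{0..<1}|lborel. additive_char (x * a)) * (LINT y:{0..<1}|lborel. additive_char (y * b))"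
    unfolding set_lebesgue_integral_def integral_mult_right_zero integral_mult_left_zero ..
  also have "\<dots> = of_bool (\<delta> = 0)"
    using ab by (simp add: integral_char_unit_interval \<delta> zero_prod_def)
  finally show ?thesis .
qed

text \<open>Frequencies may repeat. Orthogonality leaves the pairs with equal frequency; the
  arithmetic-geometric mean inequality splits each product of coefficients, and every index is then
  counted at most \<open>N\<close> times.\<close>

lemma trig_poly_mean_square_le:
  fixes d :: "'p \<Rightarrow> real \<times> real" and A :: "'p \<Rightarrow> complex"
  assumes P: "finite P" and d: "\<And>p. p \<in> P \<Longrightarrow> d p \<in> \<int> \<times> \<int>"
    and N: "\<And>p. p \<in> P \<Longrightarrow> card {q \<in> P. d q = d p} \<le> N"
  shows "(LINT x:{0..<1} \<times> {0..<1}|lborel. (cmod (\<Sum>p\<in>P. A p * additive_char (x \<bullet> d p)))\<^sup>2)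
    \<le> real N * (\<Sum>p\<in>P. (cmod (A p))\<^sup>2)" (is "?L \<le> ?R")
proof -
  let ?Q = "{0..<1} \<times> {0..<1} :: (real \<times> real) set"
  have dd: "d p - d q \<in> \<int> \<times> \<int>" if "p \<in> P" "q \<in> P" for p q
    using d[OF that(1)] d[OF that(2)] by (auto simp: mem_Times_iff)
  have int: "integrable lborel (\<lambda>x. indicator ?Q x *\<^sub>R additive_char (x \<bullet> \<delta>))" for \<delta>
    using set_integrable_char[of ?Q \<delta>]
    by (simp add: set_integrable_def borel_Times bounded_Times)
  have sq: "complex_of_real ((cmod (\<Sum>p\<in>P. A p * additive_char (x \<bullet> d p)))\<^sup>2)
      = (\<Sum>p\<in>P. \<Sum>q\<in>P. A p * cnj (A q) * additive_char (x \<bullet> (d p - d q)))" for x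
    unfolding complex_norm_square
    by (simp add: sum_product cnj_additive_char inner_diff_right mult_ac
        flip: additive_char_add)
  have "complex_of_real ?L = (LINT x:?Q|lborel. complex_of_real ((cmod (\<Sum>p\<in>P. A p * additive_char (x \<bullet> d p)))\<^sup>2))"
    by (rule set_integral_complex_of_real[symmetric])
  also have "\<dots> = (LINT x|lborel. (\<Sum>p\<in>P. \<Sum>q\<in>P. (A p * cnj (A q)) * (indicator ?Q x *\<^sub>R additive_char (x \<bullet> (d p - d q)))))"
    unfolding sq set_lebesgue_integral_def by (simp add: scaleR_sum_right)
  also have "\<dots> = (\<Sum>p\<in>P. \<Sum>q\<in>P. (A p * cnj (A q)) * (LINT x:?Q|lborel. additive_char (x \<bullet> (d p - d q))))"
    unfolding set_lebesgue_integral_def using int by (simp del: mult_scaleR_right)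
  also have "\<dots> = (\<Sum>p\<in>P. \<Sum>q\<in>P. (A p * cnj (A q)) * of_bool (d q = d p))"
    by (intro sum.cong refl) (auto simp: integral_char_unit_square[OF dd])
  finally have L: "complex_of_real ?L = (\<Sum>p\<in>P. \<Sum>q\<in>P. (A p * cnj (A q)) * of_bool (d q = d p))" .
  have "\<bar>?L\<bar> = cmod (\<Sum>p\<in>P. \<Sum>q\<in>P. (A p * cnj (A q)) * of_bool (d q = d p))"
    unfolding L[symmetric] norm_of_real ..
  also have "\<dots> \<le> (\<Sum>p\<in>P. \<Sum>q\<in>P. cmod ((A p * cnj (A q)) * of_bool (d q = d p)))"
    by (intro order.trans[OF norm_sum] sum_mono norm_sum)
  also have "\<dots> \<le> (\<Sum>p\<in>P. \<Sum>q\<in>P. ((cmod (A p))\<^sup>2 / 2 + (cmod (A q))\<^sup>2 / 2) * of_bool (d q = d p))"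
  proof (intro sum_mono)
    fix p q
    show "cmod ((A p * cnj (A q)) * of_bool (d q = d p)) \<le> ((cmod (A p))\<^sup>2 / 2 + (cmod (A q))\<^sup>2 / 2) * of_bool (d q = d p)"
      using sum_squares_bound[of "cmod (A p)" "cmod (A q)"] by (simp add: norm_mult)
  qed
  also have "\<dots> = (\<Sum>p\<in>P. \<Sum>q\<in>P. (cmod (A p))\<^sup>2 / 2 * of_bool (d q = d p))
      + (\<Sum>p\<in>P. \<Sum>q\<in>P. (cmod (A q))\<^sup>2 / 2 * of_bool (d q = d p))"
    by (simp only: distrib_right sum.distrib)
  also have "(\<Sum>p\<in>P. \<Sum>q\<in>P. (cmod (A q))\<^sup>2 / 2 * of_bool (d q = d p))
      = (\<Sum>p\<in>P. \<Sum>q\<in>P. (cmod (A p))\<^sup>2 / 2 * of_bool (d q = d p))"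
    by (subst sum.swap) (intro sum.cong refl, auto)
  also have "(\<Sum>p\<in>P. \<Sum>q\<in>P. (cmod (A p))\<^sup>2 / 2 * of_bool (d q = d p))
      = (\<Sum>p\<in>P. (cmod (A p))\<^sup>2 / 2 * real (card {q \<in> P. d q = d p}))"
    by (simp only: sum_distrib_left[symmetric]) (simp add: P Int_def)
  also have "\<dots> + \<dots> = (\<Sum>p\<in>P. (cmod (A p))\<^sup>2 * real (card {q \<in> P. d q = d p}))"
    by (simp flip: sum.distrib)
  also have "\<dots> \<le> (\<Sum>p\<in>P. (cmod (A p))\<^sup>2 * real N)"
    by (intro sum_mono mult_left_mono) (auto simp: N)
  also have "\<dots> = ?R" by (simp add: sum_distrib_left mult.commute)
  finally show ?thesis by simp
qed

section \<open>Chords of a circle and the variance\<close>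

lemma eq_0_if_orthogonal_pair:
  fixes z v w :: "real \<times> real"
  assumes "v \<noteq> 0" "w \<noteq> 0" "v \<bullet> w = 0" "z \<bullet> v = 0" "z \<bullet> w = 0"
  shows "z = 0"
proof -
  obtain z1 z2 v1 v2 w1 w2 where e: "z = (z1, z2)" "v = (v1, v2)" "w = (w1, w2)"
    by (cases z, cases v, cases w) auto
  have o: "v1 * w1 + v2 * w2 = 0" "z1 * v1 + z2 * v2 = 0" "z1 * w1 + z2 * w2 = 0"
    using assms by (auto simp: e)
  \<comment> \<open>Lagrange's identity shows that the determinant of the two vectors is nonzero;
    elimination then forces both coordinates of \<open>z\<close> to vanish.\<close>
  have "(v1 * w2 - v2 * w1)\<^sup>2 + (v1 * w1 + v2 * w2)\<^sup>2 = (v1\<^sup>2 + v2\<^sup>2) * (w1\<^sup>2 + w2\<^sup>2)"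
    by algebra
  moreover have "v1\<^sup>2 + v2\<^sup>2 \<noteq> 0" "w1\<^sup>2 + w2\<^sup>2 \<noteq> 0"
    using assms(1,2) by (auto simp: e zero_prod_def sum_power2_eq_zero_iff)
  ultimately have D: "v1 * w2 - v2 * w1 \<noteq> 0" using o(1) by auto
  have "z1 * (v1 * w2 - v2 * w1) = 0" "z2 * (v1 * w2 - v2 * w1) = 0"
    using o by algebra+
  then show ?thesis using D by (simp add: e zero_prod_def)
qed

text \<open>The initial points of all chords with difference \<delta> lie on one line perpendicular
  to \<delta>, and a line meets a circle in at most two points. The second chord is the antipode of
  the first, with its ends exchanged.\<close>

lemma equal_chords_of_circle:
  fixes \<mu> \<nu> \<mu>' \<nu>' :: "real \<times> real"
  assumes n: "norm \<nu> = norm \<mu>" "norm \<mu>' = norm \<mu>" "norm \<nu>' = norm \<mu>"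
    and eq: "\<mu>' - \<nu>' = \<mu> - \<nu>" and ne: "\<mu> \<noteq> \<nu>"
  shows "(\<mu>', \<nu>') = (\<mu>, \<nu>) \<or> (\<mu>', \<nu>') = (- \<nu>, - \<mu>)"
proof (cases "\<nu>' = \<nu>")
  case True
  with eq show ?thesis by simp
next
  case False
  define \<delta> where "\<delta> = \<mu> - \<nu>"
  have \<mu>: "\<mu> = \<nu> + \<delta>" "\<mu>' = \<nu>' + \<delta>" using eq by (simp_all add: \<delta>_def algebra_simps)
  have sq: "\<nu> \<bullet> \<nu> = \<mu> \<bullet> \<mu>" "\<mu>' \<bullet> \<mu>' = \<mu> \<bullet> \<mu>" "\<nu>' \<bullet> \<nu>' = \<mu> \<bullet> \<mu>"
    using n by (simp_all add: dot_square_norm)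
  have d: "2 * (\<nu> \<bullet> \<delta>) = - (\<delta> \<bullet> \<delta>)" "2 * (\<nu>' \<bullet> \<delta>) = - (\<delta> \<bullet> \<delta>)"
    using sq unfolding \<mu> by (simp_all add: inner_add_left inner_add_right inner_commute)
  \<comment> \<open>This vector is \<open>\<nu>' + \<mu>\<close>. It is orthogonal to \<delta> and
    to \<open>\<nu>' - \<nu>\<close>, which are themselves nonzero and orthogonal.\<close>
  have "\<nu> + \<nu>' + \<delta> = 0"
  proof (rule eq_0_if_orthogonal_pair[of \<delta> "\<nu>' - \<nu>"])
    show "\<delta> \<noteq> 0" "\<nu>' - \<nu> \<noteq> 0" using ne False by (simp_all add: \<delta>_def)
    show o: "\<delta> \<bullet> (\<nu>' - \<nu>) = 0" using d by (simp add: inner_diff_right inner_commute)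
    show "(\<nu> + \<nu>' + \<delta>) \<bullet> \<delta> = 0" using d by (simp add: inner_add_left)
    show "(\<nu> + \<nu>' + \<delta>) \<bullet> (\<nu>' - \<nu>) = 0"
      using o sq inner_commute[of \<nu>' \<nu>]
      unfolding inner_add_left inner_diff_right by linarith
  qed
  then have "\<nu>' = - \<mu>" by (simp add: \<mu>(1) add_eq_0_iff algebra_simps)
  then show ?thesis using \<mu> by simp
qed

lemma card_equal_chords_le:
  assumes "\<mu> \<in> lattice_circle n" "\<nu> \<in> lattice_circle n" "\<mu> \<noteq> \<nu>"
    and P: "P \<subseteq> lattice_circle n \<times> lattice_circle n"
  shows "card {(\<mu>', \<nu>') \<in> P. \<mu>' - \<nu>' = \<mu> - \<nu>} \<le> 2"
proof -
  have nrm: "norm x = sqrt (of_int n)" if "x \<in> lattice_circle n" for x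
    using that real_sqrt_unique[of "norm x" "of_int n"] by (simp add: lattice_circle_def)
  have "{(\<mu>', \<nu>') \<in> P. \<mu>' - \<nu>' = \<mu> - \<nu>} \<subseteq> {(\<mu>, \<nu>), (- \<nu>, - \<mu>)}"
  proof
    fix q assume "q \<in> {(\<mu>', \<nu>') \<in> P. \<mu>' - \<nu>' = \<mu> - \<nu>}"
    moreover obtain \<mu>' \<nu>' where q: "q = (\<mu>', \<nu>')" by (cases q)
    ultimately have "(\<mu>', \<nu>') \<in> P" and d: "\<mu>' - \<nu>' = \<mu> - \<nu>" by simp_all
    then have E: "\<mu>' \<in> lattice_circle n" "\<nu>' \<in> lattice_circle n" using P by blast+
    have "(\<mu>', \<nu>') = (\<mu>, \<nu>) \<or> (\<mu>', \<nu>') = (- \<nu>, - \<mu>)"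
      using d assms(3) by (rule equal_chords_of_circle[rotated 3])
        (simp_all only: nrm[OF assms(1)] nrm[OF assms(2)] nrm[OF E(1)] nrm[OF E(2)])
    then show "q \<in> {(\<mu>, \<nu>), (- \<nu>, - \<mu>)}" unfolding q by blast
  qed
  then have "card {(\<mu>', \<nu>') \<in> P. \<mu>' - \<nu>' = \<mu> - \<nu>} \<le> card {(\<mu>, \<nu>), (- \<nu>, - \<mu>)}"
    by (rule card_mono[rotated]) simp
  also have "\<dots> \<le> 2" by (intro card_insert_le_m1) simp_all
  finally show ?thesis .
qed

section \<open>Fourier expansion of the disc mass and its variance\<close>

lemma disc_mass_eq:
  assumes f: "toral_eigenfunction n c f"
  shows "complex_of_real (disc_mass f r x) = (\<Sum>(\<mu>, \<nu>)\<in>lattice_circle n \<times> lattice_circle n.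
    c \<mu> * cnj (c \<nu>) * disc_fourier r (\<mu> - \<nu>) * additive_char (x \<bullet> (\<mu> - \<nu>)))"
proof -
  let ?E = "lattice_circle n"
  have f_eq: "complex_of_real (f y) = (\<Sum>\<mu>\<in>?E. c \<mu> * additive_char (y \<bullet> \<mu>))" for y
    using f unfolding toral_eigenfunction_def by blast
  have sq: "complex_of_real ((f y)\<^sup>2) = (\<Sum>\<mu>\<in>?E. \<Sum>\<nu>\<in>?E. (c \<mu> * cnj (c \<nu>)) * additive_char (y \<bullet> (\<mu> - \<nu>)))" for y
  proof -
    \<comment> \<open>Since \<open>f\<close> is real, one factor may be conjugated, so that
      differences of lattice points appear as frequencies instead of sums.\<close>
    have "complex_of_real ((f y)\<^sup>2) = complex_of_real (f y) * cnj (complex_of_real (f y))"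
      by (simp add: power2_eq_square)
    also have "\<dots> = (\<Sum>\<mu>\<in>?E. \<Sum>\<nu>\<in>?E. (c \<mu> * cnj (c \<nu>)) * additive_char (y \<bullet> (\<mu> - \<nu>)))"
      unfolding f_eq
      by (simp add: sum_product cnj_additive_char inner_diff_right mult_ac flip: additive_char_add)
    finally show ?thesis .
  qed
  have int: "integrable lborel (\<lambda>y. indicator (ball x r) y *\<^sub>R additive_char (y \<bullet> \<delta>))" for \<delta>
    using set_integrable_char[of "ball x r" \<delta>] by (simp add: set_integrable_def)
  have "complex_of_real (disc_mass f r x) = (LINT y:ball x r|lborel. complex_of_real ((f y)\<^sup>2))"
    unfolding disc_mass_def by (rule set_integral_complex_of_real[symmetric])
  also have "\<dots> = (LINT y|lborel. (\<Sum>\<mu>\<in>?E. \<Sum>\<nu>\<in>?E. (c \<mu> * cnj (c \<nu>)) *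
      (indicator (ball x r) y *\<^sub>R additive_char (y \<bullet> (\<mu> - \<nu>)))))"
    unfolding sq set_lebesgue_integral_def by (simp add: scaleR_sum_right)
  also have "\<dots> = (\<Sum>\<mu>\<in>?E. \<Sum>\<nu>\<in>?E. (c \<mu> * cnj (c \<nu>)) * (LINT y:ball x r|lborel. additive_char (y \<bullet> (\<mu> - \<nu>))))"
    unfolding set_lebesgue_integral_def using int by (simp del: mult_scaleR_right)
  also have "\<dots> = (\<Sum>\<mu>\<in>?E. \<Sum>\<nu>\<in>?E. c \<mu> * cnj (c \<nu>) * disc_fourier r (\<mu> - \<nu>) * additive_char (x \<bullet> (\<mu> - \<nu>)))"
    by (simp add: integral_char_ball mult_ac)
  finally show ?thesis by (simp add: sum.cartesian_product)
qed

lemma disc_mass_variance_le: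
  assumes f: "toral_eigenfunction n c f" and r: "0 \<le> r"
  shows "disc_mass_variance f r \<le> 2 * (\<Sum>(\<mu>, \<nu>) | \<mu> \<in> lattice_circle n \<and> \<nu> \<in> lattice_circle n \<and> \<mu> \<noteq> \<nu>.
    (cmod (c \<mu> * c \<nu>))\<^sup>2 * (cmod (disc_fourier r (\<mu> - \<nu>)))\<^sup>2)"
proof -
  let ?E = "lattice_circle n"
  define P where "P = {(\<mu>, \<nu>). \<mu> \<in> ?E \<and> \<nu> \<in> ?E \<and> \<mu> \<noteq> \<nu>}"
  define d :: "(real \<times> real) \<times> (real \<times> real) \<Rightarrow> real \<times> real" where "d = (\<lambda>(\<mu>, \<nu>). \<mu> - \<nu>)"
  define A where "A = (\<lambda>(\<mu>, \<nu>). c \<mu> * cnj (c \<nu>) * disc_fourier r (\<mu> - \<nu>))"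
  have PE: "P \<subseteq> ?E \<times> ?E" by (auto simp: P_def)
  have finP: "finite P" using PE finite_lattice_circle by (meson finite_SigmaI finite_subset)
  \<comment> \<open>The diagonal pairs have frequency zero and total weight 1, so they contribute
    exactly the mean \<open>pi * r\<^sup>2\<close>.\<close>
  have D: "complex_of_real (disc_mass f r x - pi * r\<^sup>2) = (\<Sum>p\<in>P. A p * additive_char (x \<bullet> d p))" for x
  proof -
    have diag: "?E \<times> ?E - P = (\<lambda>\<mu>. (\<mu>, \<mu>)) ` ?E" by (auto simp: P_def)
    have "(\<Sum>p\<in>?E \<times> ?E - P. A p * additive_char (x \<bullet> d p)) = (\<Sum>\<mu>\<in>?E. of_real ((cmod (c \<mu>))\<^sup>2) * disc_fourier r 0)"
      unfolding diag complex_norm_square by (subst sum.reindex) (auto simp: inj_on_def A_def d_def)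
    also have "\<dots> = of_real (\<Sum>\<mu>\<in>?E. (cmod (c \<mu>))\<^sup>2) * of_real (pi * r\<^sup>2)"
      by (simp add: disc_fourier_0[OF r] sum_distrib_right)
    also have "\<dots> = of_real (pi * r\<^sup>2)"
      using f by (simp add: toral_eigenfunction_def)
    finally have diag_sum: "(\<Sum>p\<in>?E \<times> ?E - P. A p * additive_char (x \<bullet> d p)) = of_real (pi * r\<^sup>2)" .
    have "complex_of_real (disc_mass f r x) = (\<Sum>p\<in>?E \<times> ?E. A p * additive_char (x \<bullet> d p))"
      unfolding disc_mass_eq[OF f] by (intro sum.cong) (auto simp: A_def d_def)
    also have "\<dots> = (\<Sum>p\<in>?E \<times> ?E - P. A p * additive_char (x \<bullet> d p)) + (\<Sum>p\<in>P. A p * additive_char (x \<bullet> d p))"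
      using PE finite_lattice_circle by (intro sum.subset_diff) auto
    finally show ?thesis by (simp add: diag_sum)
  qed
  have "disc_mass_variance f r
      = (LINT x:{0..<1} \<times> {0..<1}|lborel. (cmod (\<Sum>p\<in>P. A p * additive_char (x \<bullet> d p)))\<^sup>2)"
    unfolding disc_mass_variance_def D[symmetric] norm_of_real by simp
  also have "\<dots> \<le> real 2 * (\<Sum>p\<in>P. (cmod (A p))\<^sup>2)"
  proof (rule trig_poly_mean_square_le[OF finP])
    fix p assume p: "p \<in> P"
    then obtain \<mu> \<nu> where p_eq: "p = (\<mu>, \<nu>)" and mn: "\<mu> \<in> ?E" "\<nu> \<in> ?E" "\<mu> \<noteq> \<nu>" by (auto simp: P_def)
    show "d p \<in> \<int> \<times> \<int>" using mn by (auto simp: p_eq d_def lattice_circle_def mem_Times_iff)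
    have "{q \<in> P. d q = d p} = {(\<mu>', \<nu>') \<in> P. \<mu>' - \<nu>' = \<mu> - \<nu>}" by (auto simp: p_eq d_def)
    then show "card {q \<in> P. d q = d p} \<le> 2" using card_equal_chords_le[OF mn PE] by simp
  qed
  also have "\<dots> = 2 * (\<Sum>(\<mu>, \<nu>)\<in>P. (cmod (c \<mu> * c \<nu>))\<^sup>2 * (cmod (disc_fourier r (\<mu> - \<nu>)))\<^sup>2)"
    by (simp add: A_def case_prod_beta' norm_mult power_mult_distrib)
  finally show ?thesis unfolding P_def .
qed

section \<open>Splitting the variance bound into near and far pairs\<close>

theorem theorem1p6:
  "\<exists>C>0. \<forall>n\<in>sums_of_two_squares. \<forall>(c :: real \<times> real \<Rightarrow> complex) (f :: real \<times> real \<Rightarrow> real) (r :: real) (\<xi> :: real).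
     toral_eigenfunction n c f \<longrightarrow> r > 0 \<longrightarrow> \<xi> > 0 \<longrightarrow>
       disc_mass_variance f r \<le>
         C * ((\<Sum>(\<mu>, \<nu>) \<in> {(\<mu>, \<nu>). \<mu> \<in> lattice_circle n \<and> \<nu> \<in> lattice_circle n \<and>
                                    0 < norm (\<mu> - \<nu>) \<and> norm (\<mu> - \<nu>) < 1 / (\<xi> * r)}.
                 (cmod (c \<mu> * c \<nu>))\<^sup>2) + \<xi> ^ 3) * r ^ 4"
proof (intro exI[of _ "2 * pi\<^sup>2"] conjI ballI allI impI)
  \<comment> \<open>The factor 2 is the multiplicity of a chord, and \<open>pi\<^sup>2\<close> comes
    from the trivial bound \<open>pi * r\<^sup>2\<close> on the transform of the disc.\<close>
  show "0 < 2 * pi\<^sup>2" by simp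
  fix n c f and r \<xi> :: real
  assume f: "toral_eigenfunction n c f" and r: "0 < r" and \<xi>: "0 < \<xi>"
  let ?E = "lattice_circle n"
  define P where "P = {(\<mu>, \<nu>). \<mu> \<in> ?E \<and> \<nu> \<in> ?E \<and> \<mu> \<noteq> \<nu>}"
  define S where "S = {(\<mu>, \<nu>). \<mu> \<in> ?E \<and> \<nu> \<in> ?E \<and> 0 < norm (\<mu> - \<nu>) \<and> norm (\<mu> - \<nu>) < 1 / (\<xi> * r)}"
  define w where "w = (\<lambda>(\<mu>, \<nu>). (cmod (c \<mu> * c \<nu>))\<^sup>2)"
  define K where "K = (\<lambda>(\<mu>, \<nu>). (cmod (disc_fourier r (\<mu> - \<nu>)))\<^sup>2)"
  have w0: "0 \<le> w p" for p by (simp add: w_def case_prod_beta')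
  have PE: "P \<subseteq> ?E \<times> ?E" and SP: "S \<subseteq> P" by (auto simp: P_def S_def)
  have fin: "finite (?E \<times> ?E)" using finite_lattice_circle by blast
  then have finP: "finite P" using PE by (rule finite_subset[rotated])
  \<comment> \<open>The weights over all pairs factor into the square of the normalised coefficient
    sum, so the far pairs carry weight at most 1.\<close>
  have "(\<Sum>p\<in>P - S. w p) \<le> (\<Sum>p\<in>?E \<times> ?E. w p)"
    using PE w0 fin by (intro sum_mono2) auto
  also have "\<dots> = (\<Sum>\<mu>\<in>?E. (cmod (c \<mu>))\<^sup>2) * (\<Sum>\<nu>\<in>?E. (cmod (c \<nu>))\<^sup>2)"
    by (simp add: w_def sum_product sum.cartesian_product norm_mult power_mult_distrib)
  also have "\<dots> = 1" using f by (simp add: toral_eigenfunction_def)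
  finally have far: "(\<Sum>p\<in>P - S. w p) \<le> 1" .
  have near_K: "K p \<le> pi\<^sup>2 * r ^ 4" for p
  proof -
    have "K p \<le> (pi * r\<^sup>2)\<^sup>2"
      unfolding K_def using norm_disc_fourier_le[of r] r by (auto simp: case_prod_beta' intro!: power_mono)
    then show ?thesis by (simp add: power_mult_distrib)
  qed
  have far_K: "K p \<le> pi\<^sup>2 * r ^ 4 * \<xi> ^ 3" if p: "p \<in> P - S" for p
  proof -
    obtain \<mu> \<nu> where p_eq: "p = (\<mu>, \<nu>)" by (cases p)
    have ne: "\<mu> - \<nu> \<noteq> 0" and ge: "1 / (\<xi> * r) \<le> norm (\<mu> - \<nu>)"
      using p by (auto simp: p_eq P_def S_def)
    have "K p \<le> 8 * r / norm (\<mu> - \<nu>) ^ 3"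
      using disc_fourier_decay[OF _ ne, of r] r by (simp add: K_def p_eq)
    \<comment> \<open>At the threshold distance \<open>1 / (\<xi> * r)\<close> the cubic decay turns
      \<open>r\<close> into \<open>r ^ 4 * \<xi> ^ 3\<close>, the size wanted for the error
      term.\<close>
    also have "\<dots> \<le> 8 * r / (1 / (\<xi> * r)) ^ 3"
      using r \<xi> ne ge by (intro divide_left_mono power_mono mult_pos_pos) auto
    also have "\<dots> = 8 * (r ^ 4 * \<xi> ^ 3)"
      using r \<xi> by (simp add: field_simps eval_nat_numeral)
    \<comment> \<open>As 8 is below 9, hence below \<open>pi\<^sup>2\<close>, near and far pairs can
      share one constant.\<close>
    also have "\<dots> \<le> pi\<^sup>2 * (r ^ 4 * \<xi> ^ 3)"
    proof (rule mult_right_mono)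
      have "3\<^sup>2 \<le> pi\<^sup>2" using pi_gt3 by (intro power_mono) auto
      then show "8 \<le> pi\<^sup>2" by simp
    qed (use r \<xi> in simp)
    finally show ?thesis by (simp add: mult.assoc)
  qed
  have "disc_mass_variance f r \<le> 2 * (\<Sum>p\<in>P. w p * K p)"
    using disc_mass_variance_le[OF f, of r] r by (simp add: P_def w_def K_def case_prod_beta')
  also have "(\<Sum>p\<in>P. w p * K p) = (\<Sum>p\<in>P - S. w p * K p) + (\<Sum>p\<in>S. w p * K p)"
    using SP finP by (rule sum.subset_diff)
  also have "(\<Sum>p\<in>P - S. w p * K p) \<le> (\<Sum>p\<in>P - S. w p * (pi\<^sup>2 * r ^ 4 * \<xi> ^ 3))"
    by (intro sum_mono mult_left_mono far_K w0)
  also have "\<dots> = (\<Sum>p\<in>P - S. w p) * (pi\<^sup>2 * r ^ 4 * \<xi> ^ 3)"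
    by (simp add: sum_distrib_right)
  also have "\<dots> \<le> 1 * (pi\<^sup>2 * r ^ 4 * \<xi> ^ 3)"
    using far r \<xi> by (intro mult_right_mono) auto
  also have "(\<Sum>p\<in>S. w p * K p) \<le> (\<Sum>p\<in>S. w p * (pi\<^sup>2 * r ^ 4))"
    by (intro sum_mono mult_left_mono near_K w0)
  also have "\<dots> = (\<Sum>p\<in>S. w p) * (pi\<^sup>2 * r ^ 4)"
    by (simp add: sum_distrib_right)
  finally show "disc_mass_variance f r \<le> 2 * pi\<^sup>2 * ((\<Sum>(\<mu>, \<nu>) \<in> {(\<mu>, \<nu>). \<mu> \<in> ?E \<and> \<nu> \<in> ?E \<and>
      0 < norm (\<mu> - \<nu>) \<and> norm (\<mu> - \<nu>) < 1 / (\<xi> * r)}. (cmod (c \<mu> * c \<nu>))\<^sup>2) + \<xi> ^ 3) * r ^ 4"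
    unfolding S_def[symmetric] w_def[symmetric] by (simp add: algebra_simps)
qed

end
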